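(* Let $n,N_1,\dots,N_P$ be positive integers, $N=\sum_{p=1}^PN_p$, $\delta_p=n/N_p$, $\delta=n/N$, let $\sigma_W^2\ge0$, let $X$ be a real random variable with finite second moment, $Z\sim\mathcal{N}(0,1)$ independent of $X$, and let $\eta_{s,0}:\mathbb{R}\to\mathbb{R}$ ($s\ge1$) be Lipschitz. Consider the C-MP-AMP state evolution scalars $\tau_p^{s,k}$ with the communication schedule $\hat k_s=1$ for all $s$. Then for every $s\ge1$ the value $\tau_p^{s,0}$ does not depend on $p$; writing $\tau^{s,0}$ for it, for all $s\ge2$, $$(\tau^{s,0})^2=\sigma_W^2+\delta^{-1}\mathbb{E}\left[\big(\eta_{s-1,0}(X+\tau^{s-1,0}Z)-X\big)^2\right],$$ with $(\tau^{1,0})^2=\sigma_W^2+\delta^{-1}\mathbb{E}[X^2]$. Hence the recursion over $s$ is identical to the AMP state evolution over $t$: if AMP uses $\eta_t=\eta_{t+1,0}$ for $t\ge0$, then $(\tau^{t+1,0})^2=(\tau^t)^2$ for all $t\ge0$.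
   Context: AMP state evolution (single processor): $(\sigma^0)^2=\delta^{-1}\mathbb{E}[X^2]$, $(\tau^t)^2=\sigma_W^2+(\sigma^t)^2$, $(\sigma^{t+1})^2=\delta^{-1}\mathbb{E}[(\eta_t(X+\tau^tZ)-X)^2]$. C-MP-AMP state evolution with $P$ processors, outer index $s\ge1$, inner index $k\ge 0$ and $\hat k_s$ inner iterations at outer iteration $s$: $(\sigma_p^{0,\hat k_0})^2=\delta_p^{-1}\mathbb{E}[X^2]$, $(\sigma_p^{s,0})^2=(\sigma_p^{s-1,\hat k_{s-1}})^2$, $(\tau_p^{s,k})^2=\sigma_W^2+\sum_{u\ne p}(\sigma_u^{s,0})^2+(\sigma_p^{s,k})^2$, $(\sigma_p^{s,k+1})^2=\delta_p^{-1}\mathbb{E}[(\eta_{s,k}(X+\tau_p^{s,k}Z)-X)^2]$. All of $\sigma,\tau$ are taken nonnegative. *)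

theory Defs
  imports "HOL-Probability.Probability"
begin

definition denoising_mse ::
  "'a measure \<Rightarrow> ('a \<Rightarrow> real) \<Rightarrow> ('a \<Rightarrow> real) \<Rightarrow> (real \<Rightarrow> real) \<Rightarrow> real \<Rightarrow> real" where
  "denoising_mse M X Z \<eta> \<tau> = (\<integral>\<omega>. (\<eta> (X \<omega> + \<tau> * Z \<omega>) - X \<omega>)\<^sup>2 \<partial>M)"

text \<open>The state evolution equations determine the squares of the scalars; the scalars themselves
  are the nonnegative square roots. The parameter \<open>sW2\<close> is the noise variance.\<close>

function (sequential)
  amp_sigma :: "'a measure \<Rightarrow> ('a \<Rightarrow> real) \<Rightarrow> ('a \<Rightarrow> real) \<Rightarrow> real \<Rightarrow> real \<Rightarrow>
    (nat \<Rightarrow> real \<Rightarrow> real) \<Rightarrow> nat \<Rightarrow> real" and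
  amp_tau :: "'a measure \<Rightarrow> ('a \<Rightarrow> real) \<Rightarrow> ('a \<Rightarrow> real) \<Rightarrow> real \<Rightarrow> real \<Rightarrow>
    (nat \<Rightarrow> real \<Rightarrow> real) \<Rightarrow> nat \<Rightarrow> real" where
  "amp_sigma M X Z sW2 \<delta> \<eta> 0 = sqrt (inverse \<delta> * (\<integral>\<omega>. (X \<omega>)\<^sup>2 \<partial>M))"
| "amp_sigma M X Z sW2 \<delta> \<eta> (Suc t) =
    sqrt (inverse \<delta> * denoising_mse M X Z (\<eta> t) (amp_tau M X Z sW2 \<delta> \<eta> t))"
| "amp_tau M X Z sW2 \<delta> \<eta> t = sqrt (sW2 + (amp_sigma M X Z sW2 \<delta> \<eta> t)\<^sup>2)"
  by pat_completeness auto
termination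
  by (relation "inv_image less_than (\<lambda>x. case x of Inl (M, X, Z, sW2, \<delta>, \<eta>, t) \<Rightarrow> 2 * t
        | Inr (M, X, Z, sW2, \<delta>, \<eta>, t) \<Rightarrow> 2 * t + 1)") auto

text \<open>Processors are numbered \<open>1, \<dots>, P\<close>. The arguments \<open>s k p\<close> are outer index, inner index and
  processor; \<open>khat s\<close> is the number of inner iterations in outer iteration \<open>s\<close>. At \<open>s = 0\<close> only
  the value at inner index \<open>khat 0\<close> is meaningful (it initialises outer iteration \<open>1\<close>); the
  functions return the same initial value at every inner index there, and \<open>mp_tau\<close> is
  meaningful only for \<open>s \<ge> 1\<close>.\<close>

function (sequential)
  mp_sigma :: "'a measure \<Rightarrow> ('a \<Rightarrow> real) \<Rightarrow> ('a \<Rightarrow> real) \<Rightarrow> real \<Rightarrow> nat \<Rightarrow> (nat \<Rightarrow> real) \<Rightarrow>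
    (nat \<Rightarrow> nat) \<Rightarrow> (nat \<Rightarrow> nat \<Rightarrow> real \<Rightarrow> real) \<Rightarrow> nat \<Rightarrow> nat \<Rightarrow> nat \<Rightarrow> real" and
  mp_tau :: "'a measure \<Rightarrow> ('a \<Rightarrow> real) \<Rightarrow> ('a \<Rightarrow> real) \<Rightarrow> real \<Rightarrow> nat \<Rightarrow> (nat \<Rightarrow> real) \<Rightarrow>
    (nat \<Rightarrow> nat) \<Rightarrow> (nat \<Rightarrow> nat \<Rightarrow> real \<Rightarrow> real) \<Rightarrow> nat \<Rightarrow> nat \<Rightarrow> nat \<Rightarrow> real" where
  "mp_sigma M X Z sW2 P \<delta> khat \<eta> 0 k p = sqrt (inverse (\<delta> p) * (\<integral>\<omega>. (X \<omega>)\<^sup>2 \<partial>M))"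
| "mp_sigma M X Z sW2 P \<delta> khat \<eta> (Suc s) 0 p = mp_sigma M X Z sW2 P \<delta> khat \<eta> s (khat s) p"
| "mp_sigma M X Z sW2 P \<delta> khat \<eta> (Suc s) (Suc k) p =
    sqrt (inverse (\<delta> p) *
      denoising_mse M X Z (\<eta> (Suc s) k) (mp_tau M X Z sW2 P \<delta> khat \<eta> (Suc s) k p))"
| "mp_tau M X Z sW2 P \<delta> khat \<eta> s k p =
    sqrt (sW2 + (\<Sum>u\<in>{1..P} - {p}. (mp_sigma M X Z sW2 P \<delta> khat \<eta> s 0 u)\<^sup>2)
      + (mp_sigma M X Z sW2 P \<delta> khat \<eta> s k p)\<^sup>2)"
  by pat_completeness auto
termination
  by (relation "inv_image (less_than <*lex*> less_than)
        (\<lambda>x. case x of Inl (M, X, Z, sW2, P, \<delta>, khat, \<eta>, s, k, p) \<Rightarrow> (s, 2 * k)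
        | Inr (M, X, Z, sW2, P, \<delta>, khat, \<eta>, s, k, p) \<Rightarrow> (s, 2 * k + 1))") auto

end

(* With one inner iteration per outer iteration, the own term of processor p and the terms
   received from the others add up to the same sum over all processors, whatever p is. All
   processors therefore share one noise level, the mean squared error factors out of this sum,
   and what remains is the sum of the inverse delta_p, which is the inverse of delta. *)

theory Submission
  imports Defs
begin

lemma denoising_mse_nonneg: "0 \<le> denoising_mse M X Z f \<tau>"
  by (simp add: denoising_mse_def)

text \<open>At inner index 0 the own term is also a value carried over from the previous outer
  iteration, so it fills the gap left by \<open>{1..P} - {p}\<close>. This needs no restriction on
  \<open>khat\<close>.\<close>

lemma mp_tau_inner_zero:
  assumes "p \<in> {1..P}"
  shows "mp_tau M X Z sW2 P \<delta> khat \<eta> (Suc s) 0 p =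
    sqrt (sW2 + (\<Sum>u=1..P. (mp_sigma M X Z sW2 P \<delta> khat \<eta> s (khat s) u)\<^sup>2))"
  using sum.remove[OF _ assms, of "\<lambda>u. (mp_sigma M X Z sW2 P \<delta> khat \<eta> s (khat s) u)\<^sup>2"]
  by (simp add: add_ac)

lemma amp_tau_0_power2:
  assumes "sW2 \<ge> 0" and "\<delta> \<ge> 0"
  shows "(amp_tau M X Z sW2 \<delta> \<eta> 0)\<^sup>2 = sW2 + inverse \<delta> * (\<integral>\<omega>. (X \<omega>)\<^sup>2 \<partial>M)"
  using assms by simp

lemma amp_tau_Suc_power2:
  assumes "sW2 \<ge> 0" and "\<delta> \<ge> 0"
  shows "(amp_tau M X Z sW2 \<delta> \<eta> (Suc t))\<^sup>2 =
    sW2 + inverse \<delta> * denoising_mse M X Z (\<eta> t) (amp_tau M X Z sW2 \<delta> \<eta> t)"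
  using assms by (simp add: denoising_mse_nonneg del: amp_tau.simps add: amp_tau.simps[of _ _ _ _ _ _ "Suc t"])

text \<open>Induction on \<open>t\<close> with \<open>p\<close> arbitrary, because the noise level
  of one processor depends on the previous noise levels of all of them. The processor sizes enter
  only through the sum of the inverse ratios. Outer iterations start at 1 and AMP at 0, hence the
  shift.\<close>

lemma mp_tau_eq_amp_tau:
  assumes "\<And>p. p \<in> {1..P} \<Longrightarrow> \<delta>p p \<ge> 0"
    and \<delta>: "inverse \<delta> = (\<Sum>p=1..P. inverse (\<delta>p p))"
    and khat: "\<And>s. s \<ge> 1 \<Longrightarrow> khat s = 1"
    and "p \<in> {1..P}"
  shows "mp_tau M X Z sW2 P \<delta>p khat \<eta> (Suc t) 0 p =
    amp_tau M X Z sW2 \<delta> (\<lambda>t. \<eta> (t + 1) 0) t"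
  using \<open>p \<in> {1..P}\<close>
proof (induction t arbitrary: p)
  case 0
  \<comment> \<open>\<open>khat 0\<close> is unconstrained here; this is harmless since
    \<open>mp_sigma\<close> at outer index 0 is the same for every inner index.\<close>
  have "(\<Sum>u=1..P. (mp_sigma M X Z sW2 P \<delta>p khat \<eta> 0 (khat 0) u)\<^sup>2) =
      inverse \<delta> * (\<integral>\<omega>. (X \<omega>)\<^sup>2 \<partial>M)"
    unfolding \<delta> sum_distrib_right by (intro sum.cong) (simp_all add: assms(1))
  \<comment> \<open>The sign lets the square cancel the square root in
    \<open>amp_sigma\<close>.\<close>
  moreover have "inverse \<delta> \<ge> 0"
    unfolding \<delta> by (intro sum_nonneg) (simp add: assms(1))
  ultimately show ?case
    by (simp add: mp_tau_inner_zero[OF 0] del: mp_tau.simps mp_sigma.simps)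
next
  case (Suc t)
  let ?mse = "denoising_mse M X Z (\<eta> (Suc t) 0) (amp_tau M X Z sW2 \<delta> (\<lambda>t. \<eta> (t + 1) 0) t)"
  \<comment> \<open>As \<open>khat (Suc t) = 1\<close>, this value comes from a single denoising at
    inner index 0. The induction hypothesis for \<open>u\<close> turns its noise level into the AMP
    one, so \<open>?mse\<close> is free of \<open>u\<close>.\<close>
  have "(mp_sigma M X Z sW2 P \<delta>p khat \<eta> (Suc t) (khat (Suc t)) u)\<^sup>2 = inverse (\<delta>p u) * ?mse"
    if "u \<in> {1..P}" for u
    using Suc.IH[OF that] assms(1)[OF that] khat[of "Suc t"]
    by (simp add: denoising_mse_nonneg del: mp_tau.simps amp_tau.simps)
  then have "(\<Sum>u=1..P. (mp_sigma M X Z sW2 P \<delta>p khat \<eta> (Suc t) (khat (Suc t)) u)\<^sup>2) =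
      inverse \<delta> * ?mse"
    unfolding \<delta> sum_distrib_right by (intro sum.cong) simp_all
  moreover have "inverse \<delta> \<ge> 0"
    unfolding \<delta> by (intro sum_nonneg) (simp add: assms(1))
  ultimately show ?case
    by (simp add: mp_tau_inner_zero[OF Suc.prems] amp_tau.simps[of _ _ _ _ _ _ "Suc t"]
        denoising_mse_nonneg del: mp_tau.simps mp_sigma.simps amp_tau.simps)
qed

theorem mainTheorem3:
  fixes M :: "'a measure" and X Z :: "'a \<Rightarrow> real" and sW2 \<delta> :: real
    and n P :: nat and N :: "nat \<Rightarrow> nat" and \<delta>p :: "nat \<Rightarrow> real"
    and khat :: "nat \<Rightarrow> nat" and \<eta> :: "nat \<Rightarrow> nat \<Rightarrow> real \<Rightarrow> real"
  assumes "prob_space M"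
    and "n \<ge> 1" and "P \<ge> 1" and "\<And>p. p \<in> {1..P} \<Longrightarrow> N p \<ge> 1"
    and "\<And>p. p \<in> {1..P} \<Longrightarrow> \<delta>p p = real n / real (N p)"
    and "\<delta> = real n / real (\<Sum>p=1..P. N p)"
    and "sW2 \<ge> 0"
    and "X \<in> borel_measurable M" and "integrable M (\<lambda>\<omega>. (X \<omega>)\<^sup>2)"
    and "distributed M lborel Z std_normal_density"
    and "prob_space.indep_var M borel X borel Z"
    and "\<And>s. s \<ge> 1 \<Longrightarrow> \<exists>L. L-lipschitz_on UNIV (\<eta> s 0)"
    and "\<And>s. s \<ge> 1 \<Longrightarrow> khat s = 1"
  shows "\<exists>\<tau> :: nat \<Rightarrow> real.
    (\<forall>s\<ge>1. \<forall>p\<in>{1..P}. mp_tau M X Z sW2 P \<delta>p khat \<eta> s 0 p = \<tau> s) \<and>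
    (\<forall>s\<ge>2. (\<tau> s)\<^sup>2 = sW2 + inverse \<delta> *
      (\<integral>\<omega>. (\<eta> (s - 1) 0 (X \<omega> + \<tau> (s - 1) * Z \<omega>) - X \<omega>)\<^sup>2 \<partial>M)) \<and>
    (\<tau> 1)\<^sup>2 = sW2 + inverse \<delta> * (\<integral>\<omega>. (X \<omega>)\<^sup>2 \<partial>M) \<and>
    (\<forall>t. (\<tau> (t + 1))\<^sup>2 = (amp_tau M X Z sW2 \<delta> (\<lambda>t. \<eta> (t + 1) 0) t)\<^sup>2)"
proof -
  \<comment> \<open>The witness is the AMP sequence shifted by one, which makes the last claim
    immediate. The truncated value at \<open>s = 0\<close> never enters the claims.\<close>
  let ?\<tau> = "\<lambda>s. amp_tau M X Z sW2 \<delta> (\<lambda>t. \<eta> (t + 1) 0) (s - 1)"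
  \<comment> \<open>Each inverse ratio is \<open>N p / n\<close>, and these add up to the total size
    over \<open>n\<close>.\<close>
  have \<delta>: "inverse \<delta> = (\<Sum>p=1..P. inverse (\<delta>p p))"
    using assms(5,6) by (simp add: sum_divide_distrib)
  have "\<delta> \<ge> 0"
    by (simp add: assms(6) del: of_nat_sum)
  have "mp_tau M X Z sW2 P \<delta>p khat \<eta> s 0 p = ?\<tau> s" if "s \<ge> 1" "p \<in> {1..P}" for s p
    using mp_tau_eq_amp_tau[OF _ \<delta> assms(13) that(2), where t = "s - 1"] that(1) assms(5)
    by simp
  moreover have "(?\<tau> s)\<^sup>2 = sW2 + inverse \<delta> *
      (\<integral>\<omega>. (\<eta> (s - 1) 0 (X \<omega> + ?\<tau> (s - 1) * Z \<omega>) - X \<omega>)\<^sup>2 \<partial>M)" if "s \<ge> 2" for s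
  proof -
    \<comment> \<open>With \<open>s = t + 2\<close>, both the denoiser index \<open>s - 1\<close>
      and the AMP index \<open>s - 2\<close> behind \<open>?\<tau> (s - 1)\<close> are true
      differences.\<close>
    from that obtain t where "s = Suc (Suc t)"
      by (auto simp: numeral_2_eq_2 dest!: le_Suc_ex)
    then show ?thesis
      using amp_tau_Suc_power2[OF assms(7) \<open>\<delta> \<ge> 0\<close>, of M X Z "\<lambda>t. \<eta> (t + 1) 0" t]
      by (simp add: denoising_mse_def del: amp_tau.simps)
  qed
  moreover have "(?\<tau> 1)\<^sup>2 = sW2 + inverse \<delta> * (\<integral>\<omega>. (X \<omega>)\<^sup>2 \<partial>M)"
    using amp_tau_0_power2[OF assms(7) \<open>\<delta> \<ge> 0\<close>] by simp
  ultimately show ?thesis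
    by (intro exI[of _ ?\<tau>] conjI) (simp_all del: mp_tau.simps amp_tau.simps)
qed

end
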